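(* The Gröbner fan $\mathrm{GF}(\mathbf{Hilb}^n_{p(t)})$ of the Hilbert scheme is a polyhedral fan, i.e. it is a finite collection of convex polyhedral cones such that (i) every face of a cone in the collection belongs to the collection; (ii) for every pair of cones $\mathcal{C}_1,\mathcal{C}_2$ in the collection, $\mathcal{C}_1\cap\mathcal{C}_2$ is a face of $\mathcal{C}_1$ and a face of $\mathcal{C}_2$.
   Context: $\mathbb{K}$ is an algebraically closed field of characteristic $0$, $\mathbb{K}[\mathbf{x}]=\mathbb{K}[x_0,\dots,x_n]$ with the standard grading and variables ordered $x_0<\dots<x_n$. Monomials are written $\mathbf{x}^{a}$, $a\in\mathbb{Z}_{\ge0}^{n+1}$; generalized monomials are $\mathbf{x}^a$ with $a\in\mathbb{Z}^{n+1}$. $p(t)$ is the Hilbert polynomial of a closed subscheme of $\mathbb{P}^n$; the Hilbert polynomial of an ideal $I$ means that of $\mathbb{K}[\mathbf{x}]/I$. Elementary moves on generalized monomials: $\mathsf{e}^+_i(\mathbf{x}^a)=\frac{x_{i+1}}{x_i}\mathbf{x}^a$ for $i<n$ (increasing) and $\mathsf{e}^-_j(\mathbf{x}^a)=\frac{x_{j-1}}{x_j}\mathbf{x}^a$ for $j>0$ (decreasing). The Borel order $\ge_B$ on monomials of a given degree is the reflexive-transitive closure of the relations $\mathbf{x}^a>_B\mathbf{x}^b$ whenever $\mathbf{x}^a=\mathsf{e}^+_i(\mathbf{x}^b)$ for some $i$. A monomial ideal $J$ is strongly stable if $\mathbf{x}^a\ge_B\mathbf{x}^b$ and $\mathbf{x}^b\in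 J$ imply $\mathbf{x}^a\in J$. The Gotzmann number $r$ of $p(t)$ is the number of summands in its unique expression $p(t)=\sum_{i=1}^r\binom{t+a_i-i+1}{a_i}$ with $a_1\ge\dots\ge a_r\ge0$. $\mathsf{S}^n_{p(t)}$ is the (finite) set of ideals $J=J^{\mathrm{sat}}_{\ge r}$ where $J^{\mathrm{sat}}$ is a saturated strongly stable ideal with Hilbert polynomial $p(t)$. $\mathfrak{J}$ is the set of monomials of degree $r$ in $J$. $J,J'\in\mathsf{S}^n_{p(t)}$ are Borel adjacent if (1) $\mathfrak{J}\setminus\mathfrak{J}'$ has a maximum $\mathbf{x}^a$ with respect to $\ge_B$ and $\mathfrak{J}'\setminus\mathfrak{J}$ has a maximum $\mathbf{x}^{a'}$ with respect to $\ge_B$ (the Borel maxima); and (2) there is a set $\mathcal{E}_{J,J'}$ consisting of the identity map and compositions of decreasing elementary moves such that $\mathfrak{J}\setminus\mathfrak{J}'=\{\mathsf{E}(\mathbf{x}^a):\mathsf{E}\in\mathcal{E}_{J,J'}\}$ and $\mathfrak{J}'\setminus\mathfrak{J}=\{\mathsf{E}(\mathbf{x}^{a'}):\mathsf{E}\in\mathcal{E}_{J,J'}\}$. For $\omega\in\mathbb{R}^{n+1}$, the $\omega$-degeneration graph $\mathscr{G}^n_{p(t)}(\omega)$ is the mixed graph with vertex set $\mathsf{S}^n_{p(t)}$, and with, for every pair of Borel adjacent ideals $J,J'$ with Borel maxima $\mathbf{x}^a$ of $\mathfrak{J}\setminus\mathfrak{J}'$ and $\mathbf{x}^{a'}$ of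 $\mathfrak{J}'\setminus\mathfrak{J}$: an undirected edge $\{J,J'\}$ if $\langle a,\omega\rangle=\langle a',\omega\rangle$, and a directed edge from $J$ to $J'$ if $\langle a,\omega\rangle>\langle a',\omega\rangle$. Define an equivalence relation on $\mathbb{R}^{n+1}$ by $\omega\sim\sigma\iff\mathscr{G}^n_{p(t)}(\omega)=\mathscr{G}^n_{p(t)}(\sigma)$. Let $\mathcal{W}=\{\omega\in\mathbb{R}^{n+1}_{>0}:\omega_i<\omega_{i+1},\ i=0,\dots,n-1\}$. The Gröbner fan $\mathrm{GF}(\mathbf{Hilb}^n_{p(t)})$ is the collection of the cones $\overline{\mathcal{C}}\cap\overline{\mathcal{W}}$, for $\mathcal{C}$ ranging over the equivalence classes of $\sim$ (bars denote closures), together with all their faces. *)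

theory Defs
  imports
    "HOL-Analysis.Analysis"
    "HOL-Library.Poly_Mapping"
    "HOL-Computational_Algebra.Polynomial"
begin

section \<open>Polynomials, monomials and ideals\<close>

text \<open>
  The variables \<open>x\<^sub>0 < \<dots> < x\<^sub>n\<close> are indexed by a finite linearly ordered type \<open>'n\<close>, so
  \<open>n + 1 = CARD('n)\<close>. A monomial is its exponent vector, and the polynomial ring
  \<open>K[x\<^sub>0, \<dots>, x\<^sub>n]\<close> is the monoid algebra over exponent vectors, with the ring structure of
  \<^theory>\<open>HOL-Library.Poly_Mapping\<close>.
\<close>

type_synonym 'n mon = "'n \<Rightarrow>\<^sub>0 nat"
type_synonym ('n, 'k) mpoly = "'n mon \<Rightarrow>\<^sub>0 'k"

definition mdeg :: "'n::finite mon \<Rightarrow> nat" where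
  "mdeg m = (\<Sum>i\<in>UNIV. Poly_Mapping.lookup m i)"

definition monomial :: "'n mon \<Rightarrow> ('n, 'k::comm_ring_1) mpoly" where
  "monomial m = Poly_Mapping.single m 1"

definition homogeneous :: "nat \<Rightarrow> ('n::finite, 'k::zero) mpoly \<Rightarrow> bool" where
  "homogeneous d f \<longleftrightarrow> (\<forall>m\<in>Poly_Mapping.keys f. mdeg m = d)"

definition scale :: "'k::comm_ring_1 \<Rightarrow> ('n, 'k) mpoly \<Rightarrow> ('n, 'k) mpoly" where
  "scale c f = Poly_Mapping.single 0 c * f"

lemma vector_space_scale: "vector_space (scale :: 'k::field \<Rightarrow> ('n, 'k) mpoly \<Rightarrow> _)"
  by unfold_locales
    (simp_all add: scale_def algebra_simps Poly_Mapping.single_add mult_single flip: mult.assoc)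

text \<open>Ideals are the submodules of the ring over itself.\<close>

lemma module_times: "module ((*) :: 'a::comm_ring_1 \<Rightarrow> 'a \<Rightarrow> 'a)"
  by unfold_locales (simp_all add: algebra_simps)

definition ideal_gen :: "'a::comm_ring_1 set \<Rightarrow> 'a set" where
  "ideal_gen = module.span (*)"

definition homogeneous_ideal :: "('n::finite, 'k::comm_ring_1) mpoly set \<Rightarrow> bool" where
  "homogeneous_ideal I \<longleftrightarrow> (\<exists>F. (\<forall>f\<in>F. \<exists>d. homogeneous d f) \<and> I = ideal_gen F)"

definition monomial_ideal :: "('n, 'k::comm_ring_1) mpoly set \<Rightarrow> bool" where
  "monomial_ideal I \<longleftrightarrow> (\<exists>M. I = ideal_gen (monomial ` M))"

text \<open>
  Saturation with respect to the irrelevant ideal \<open>\<mm> = (x\<^sub>0, \<dots>, x\<^sub>n)\<close>: the union of the colon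
  ideals \<open>I : \<mm>\<^sup>k\<close>, where \<open>\<mm>\<^sup>k\<close> is generated by the monomials of degree \<open>k\<close>.
\<close>

definition saturation :: "('n::finite, 'k::comm_ring_1) mpoly set \<Rightarrow> ('n, 'k) mpoly set" where
  "saturation I = {f. \<exists>k. \<forall>m. mdeg m = k \<longrightarrow> monomial m * f \<in> I}"

definition saturated :: "('n::finite, 'k::comm_ring_1) mpoly set \<Rightarrow> bool" where
  "saturated I \<longleftrightarrow> saturation I = I"

text \<open>\<open>I\<^sub>\<ge>\<^sub>r\<close> for a homogeneous ideal \<open>I\<close>.\<close>

definition truncation :: "nat \<Rightarrow> ('n::finite, 'k::zero) mpoly set \<Rightarrow> ('n, 'k) mpoly set" where
  "truncation r I = {f \<in> I. \<forall>m\<in>Poly_Mapping.keys f. r \<le> mdeg m}"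

section \<open>Hilbert polynomials and the Gotzmann number\<close>

text \<open>
  The dimension over \<open>K\<close> of the degree-\<open>t\<close> part of \<open>K[x]/I\<close>, for a homogeneous ideal \<open>I\<close>.
\<close>

definition hilbert_function :: "('n::finite, 'k::field) mpoly set \<Rightarrow> nat \<Rightarrow> nat" where
  "hilbert_function I t =
     vector_space.dim scale {f :: ('n, 'k) mpoly. homogeneous t f}
     - vector_space.dim scale {f \<in> I. homogeneous t f}"

definition has_hilbert_poly :: "('n::finite, 'k::field) mpoly set \<Rightarrow> rat poly \<Rightarrow> bool" where
  "has_hilbert_poly I p \<longleftrightarrow>
     (\<forall>\<^sub>F t in sequentially. of_nat (hilbert_function I t) = poly p (of_nat t))"

text \<open>\<open>as ! (i - 1)\<close> is \<open>a\<^sub>i\<close>.\<close>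

definition gotzmann_expression :: "rat poly \<Rightarrow> nat list \<Rightarrow> bool" where
  "gotzmann_expression p as \<longleftrightarrow>
     sorted_wrt (\<ge>) as \<and>
     (\<forall>t. poly p t =
       (\<Sum>i = 1..length as.
          (t + of_nat (as ! (i - 1)) - of_nat i + 1) gchoose (as ! (i - 1))))"

definition gotzmann_number :: "rat poly \<Rightarrow> nat" where
  "gotzmann_number p = (THE r. \<exists>as. gotzmann_expression p as \<and> length as = r)"

section \<open>The Borel order\<close>

text \<open>Generalized monomials have type \<open>'n \<Rightarrow> int\<close>.\<close>

definition gen_mon :: "'n mon \<Rightarrow> 'n \<Rightarrow> int" where
  "gen_mon a = (\<lambda>i. int (Poly_Mapping.lookup a i))"

text \<open>
  \<open>next_ix i\<close> is \<open>i + 1\<close>, meaningful for \<open>i < n\<close>, and \<open>prev_ix j\<close> is \<open>j - 1\<close>, meaningful for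
  \<open>j > 0\<close>; the elementary moves are only used for such indices.
\<close>

definition next_ix :: "'n::{finite,linorder} \<Rightarrow> 'n" where
  "next_ix i = Min {j. i < j}"

definition prev_ix :: "'n::{finite,linorder} \<Rightarrow> 'n" where
  "prev_ix j = Max {i. i < j}"

definition e_inc :: "'n::{finite,linorder} \<Rightarrow> ('n \<Rightarrow> int) \<Rightarrow> ('n \<Rightarrow> int)" where
  "e_inc i a = a(i := a i - 1, next_ix i := a (next_ix i) + 1)"

definition e_dec :: "'n::{finite,linorder} \<Rightarrow> ('n \<Rightarrow> int) \<Rightarrow> ('n \<Rightarrow> int)" where
  "e_dec j a = a(j := a j - 1, prev_ix j := a (prev_ix j) + 1)"

definition borel_step :: "'n::{finite,linorder} mon \<Rightarrow> 'n mon \<Rightarrow> bool" where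
  "borel_step a b \<longleftrightarrow> (\<exists>i < Max UNIV. gen_mon a = e_inc i (gen_mon b))"

definition borel_ge :: "'n::{finite,linorder} mon \<Rightarrow> 'n mon \<Rightarrow> bool" where
  "borel_ge = borel_step\<^sup>*\<^sup>*"

definition is_borel_max :: "'n::{finite,linorder} mon set \<Rightarrow> 'n mon \<Rightarrow> bool" where
  "is_borel_max A a \<longleftrightarrow> a \<in> A \<and> (\<forall>b\<in>A. borel_ge a b)"

definition strongly_stable :: "('n::{finite,linorder}, 'k::comm_ring_1) mpoly set \<Rightarrow> bool" where
  "strongly_stable J \<longleftrightarrow>
     monomial_ideal J \<and>
     (\<forall>a b. borel_ge a b \<longrightarrow> monomial b \<in> J \<longrightarrow> monomial a \<in> J)"

definition stable_ideals ::
    "rat poly \<Rightarrow> ('n::{finite,linorder}, 'k::field) mpoly set set" where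
  "stable_ideals p =
     {truncation (gotzmann_number p) I | I.
        strongly_stable I \<and> saturated I \<and> has_hilbert_poly I p}"

section \<open>Borel adjacency and the degeneration graph\<close>

definition mons_of_degree :: "nat \<Rightarrow> ('n::finite, 'k::comm_ring_1) mpoly set \<Rightarrow> 'n mon set" where
  "mons_of_degree r J = {m. mdeg m = r \<and> monomial m \<in> J}"

inductive_set decreasing_compositions ::
    "(('n::{finite,linorder} \<Rightarrow> int) \<Rightarrow> ('n \<Rightarrow> int)) set" where
  move: "Min UNIV < j \<Longrightarrow> e_dec j \<in> decreasing_compositions"
| comp: "Min UNIV < j \<Longrightarrow> E \<in> decreasing_compositions \<Longrightarrow>
           e_dec j \<circ> E \<in> decreasing_compositions"

text \<open>
  \<open>borel_adjacent r J J' a a'\<close>: \<open>J\<close> and \<open>J'\<close> are Borel adjacent, with Borel maxima \<open>a\<close> and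
  \<open>a'\<close> (which are unique, the Borel order being antisymmetric).
\<close>

definition borel_adjacent ::
    "nat \<Rightarrow> ('n::{finite,linorder}, 'k::comm_ring_1) mpoly set \<Rightarrow> ('n, 'k) mpoly set \<Rightarrow>
     'n mon \<Rightarrow> 'n mon \<Rightarrow> bool" where
  "borel_adjacent r J J' a a' \<longleftrightarrow>
     is_borel_max (mons_of_degree r J - mons_of_degree r J') a \<and>
     is_borel_max (mons_of_degree r J' - mons_of_degree r J) a' \<and>
     (\<exists>\<E>. id \<in> \<E> \<and> \<E> \<subseteq> insert id decreasing_compositions \<and>
        gen_mon ` (mons_of_degree r J - mons_of_degree r J') = {E (gen_mon a) | E. E \<in> \<E>} \<and>
        gen_mon ` (mons_of_degree r J' - mons_of_degree r J) = {E (gen_mon a') | E. E \<in> \<E>})"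

record 'v mixed_graph =
  vertices :: "'v set"
  undirected_edges :: "'v set set"
  directed_edges :: "('v \<times> 'v) set"

definition weight :: "'n::finite mon \<Rightarrow> real ^ 'n \<Rightarrow> real" where
  "weight a \<omega> = (\<chi> i. real (Poly_Mapping.lookup a i)) \<bullet> \<omega>"

definition degeneration_graph ::
    "rat poly \<Rightarrow> real ^ 'n::{finite,linorder} \<Rightarrow> ('n::{finite,linorder}, 'k::field) mpoly set mixed_graph" where
  "degeneration_graph p \<omega> =
     \<lparr> vertices = stable_ideals p,
       undirected_edges =
         {{J, J'} | J J'. J \<in> stable_ideals p \<and> J' \<in> stable_ideals p \<and>
            (\<exists>a a'. borel_adjacent (gotzmann_number p) J J' a a' \<and> weight a \<omega> = weight a' \<omega>)},
       directed_edges =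
         {(J, J') | J J'. J \<in> stable_ideals p \<and> J' \<in> stable_ideals p \<and>
            (\<exists>a a'. borel_adjacent (gotzmann_number p) J J' a a' \<and> weight a \<omega> > weight a' \<omega>)} \<rparr>"

section \<open>The Groebner fan of the Hilbert scheme\<close>

text \<open>
  The coefficient field \<open>'k\<close> does not occur in the types of weights and cones, so it is passed as
  a type argument.
\<close>

definition graph_equiv ::
    "'k::field itself \<Rightarrow> rat poly \<Rightarrow> ((real ^ 'n::{finite,linorder}) \<times> (real ^ 'n::{finite,linorder})) set" where
  "graph_equiv _ p =
     {(\<omega>, \<sigma>). (degeneration_graph p \<omega> :: ('n, 'k) mpoly set mixed_graph) = degeneration_graph p \<sigma>}"

definition weight_chamber :: "(real ^ 'n::{finite,linorder}) set" where
  "weight_chamber = {\<omega>. (\<forall>i. 0 < \<omega> $ i) \<and> (\<forall>i < Max UNIV. \<omega> $ i < \<omega> $ next_ix i)}"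

text \<open>
  Faces of a cone are nonempty; the library notion \<^const>\<open>face_of\<close> also admits the empty set.
\<close>

definition cone_face :: "'a::real_vector set \<Rightarrow> 'a set \<Rightarrow> bool" where
  "cone_face F C \<longleftrightarrow> F \<noteq> {} \<and> F face_of C"

definition groebner_cones ::
    "'k::field itself \<Rightarrow> rat poly \<Rightarrow> (real ^ 'n::{finite,linorder}) set set" where
  "groebner_cones K p = {closure C \<inter> closure weight_chamber | C. C \<in> UNIV // graph_equiv K p}"

definition groebner_fan ::
    "'k::field itself \<Rightarrow> rat poly \<Rightarrow> (real ^ 'n::{finite,linorder}) set set" where
  "groebner_fan K p = groebner_cones K p \<union> {F. \<exists>C \<in> groebner_cones K p. cone_face F C}"

section \<open>Polyhedral fans\<close>

definition polyhedral_cone :: "'a::euclidean_space set \<Rightarrow> bool" where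
  "polyhedral_cone C \<longleftrightarrow> C \<noteq> {} \<and> cone C \<and> polyhedron C"

definition polyhedral_fan :: "'a::euclidean_space set set \<Rightarrow> bool" where
  "polyhedral_fan \<F> \<longleftrightarrow>
     finite \<F> \<and>
     (\<forall>C\<in>\<F>. polyhedral_cone C) \<and>
     (\<forall>C\<in>\<F>. \<forall>F. cone_face F C \<longrightarrow> F \<in> \<F>) \<and>
     (\<forall>C\<^sub>1\<in>\<F>. \<forall>C\<^sub>2\<in>\<F>. cone_face (C\<^sub>1 \<inter> C\<^sub>2) C\<^sub>1 \<and> cone_face (C\<^sub>1 \<inter> C\<^sub>2) C\<^sub>2)"

end

theory Submission
  imports Defs
begin

text \<open>
  The degeneration graph at \<open>\<omega>\<close> records, for each pair of Borel adjacent ideals with Borel maxima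
  \<open>a\<close> and \<open>a'\<close>, the sign of \<open>\<langle>a - a', \<omega>\<rangle>\<close>. Borel maxima are unique, so the graph and these signs
  determine each other, and since \<open>a\<close> and \<open>a'\<close> have the fixed degree \<open>r\<close>, only finitely many
  vectors \<open>a - a'\<close> occur. The equivalence classes of weights are therefore the cells of a finite
  central hyperplane arrangement \<open>V\<close>. The closure of a nonempty cell is obtained by
  weakening its strict inequalities, and the same holds for the chamber \<open>\<W>\<close>, which is a cell of
  the arrangement \<open>U\<close> of its walls. So every generating cone of the fan is cut out by
  sign conditions on the finite set \<open>V \<union> U\<close>.

  It remains to see that such cones fit together. A nonempty face of a cone given by sign conditions
  is the closed cell, in the arrangement \<open>V \<union> U\<close>, of any point of its relative interior
  (\<open>face_of_sign_cone\<close>). Hence every member of the Groebner fan is a closed cell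
  of one and the same arrangement; there are finitely many of them, they are polyhedral cones, and
  any two meet in a common face (\<open>closed_cells_meet_in_face\<close>).
\<close>

section \<open>Closed cells of central hyperplane arrangements\<close>

text \<open>
  The constraints form a relation, not a function from vectors to signs: intersecting the closed
  cells of two arrangements may impose two different signs on a vector that they share, which then
  has to vanish.
\<close>

definition sign_cone :: "('a::real_inner \<times> real) set \<Rightarrow> 'a set" where
  "sign_cone S = {x. \<forall>v s. (v, s) \<in> S \<longrightarrow> sgn (v \<bullet> x) \<in> {0, s}}"

definition closed_cell :: "'a::real_inner set \<Rightarrow> 'a \<Rightarrow> 'a set" where
  "closed_cell A z = sign_cone ((\<lambda>v. (v, sgn (v \<bullet> z))) ` A)"

lemma mem_closed_cell: "x \<in> closed_cell A z \<longleftrightarrow> (\<forall>v\<in>A. sgn (v \<bullet> x) \<in> {0, sgn (v \<bullet> z)})"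
  by (auto simp: closed_cell_def sign_cone_def)

lemma sign_cone_Un: "sign_cone (S \<union> T) = sign_cone S \<inter> sign_cone T"
  by (auto simp: sign_cone_def)

lemma polyhedron_sign_condition:
  fixes v :: "'a::euclidean_space"
  shows "polyhedron {x. sgn (v \<bullet> x) \<in> {0, s}}"
proof -
  consider "s = 1" | "s = -1" | "s \<noteq> 1" "s \<noteq> -1" by blast
  then show ?thesis
  proof cases
    case 1
    then have "{x. sgn (v \<bullet> x) \<in> {0, s}} = {x. v \<bullet> x \<ge> 0}"
      by (auto simp: sgn_real_def)
    then show ?thesis by (simp add: polyhedron_halfspace_ge)
  next
    case 2
    then have "{x. sgn (v \<bullet> x) \<in> {0, s}} = {x. v \<bullet> x \<le> 0}"
      by (auto simp: sgn_real_def)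
    then show ?thesis by (simp add: polyhedron_halfspace_le)
  next
    case 3
    then have "{x. sgn (v \<bullet> x) \<in> {0, s}} = {x. v \<bullet> x = 0}"
      by (auto simp: sgn_real_def)
    then show ?thesis by (simp add: polyhedron_hyperplane)
  qed
qed

lemma polyhedral_cone_sign_cone:
  fixes S :: "('a::euclidean_space \<times> real) set"
  assumes "finite S"
  shows "polyhedral_cone (sign_cone S)"
proof -
  have "sign_cone S = (\<Inter>c\<in>S. {x. sgn (fst c \<bullet> x) \<in> {0, snd c}})"
    by (force simp: sign_cone_def)
  then have "polyhedron (sign_cone S)"
    using assms polyhedron_sign_condition by (auto intro!: polyhedron_Inter simp del: insert_iff)
  moreover have "0 \<in> sign_cone S" by (auto simp: sign_cone_def)
  moreover have "cone (sign_cone S)"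
    unfolding cone_def
  proof (intro ballI allI impI)
    fix x and c :: real assume x: "x \<in> sign_cone S" and "0 \<le> c"
    then consider "c = 0" | "c > 0" by linarith
    then show "c *\<^sub>R x \<in> sign_cone S"
      by cases (use x in \<open>simp_all add: sign_cone_def sgn_mult\<close>)
  qed
  ultimately show ?thesis by (auto simp: polyhedral_cone_def)
qed

lemma polyhedral_cone_closed_cell:
  "finite A \<Longrightarrow> polyhedral_cone (closed_cell A z)" for z :: "'a::euclidean_space"
  by (simp add: closed_cell_def polyhedral_cone_sign_cone)

lemma convex_sign_cone:
  "finite S \<Longrightarrow> convex (sign_cone S)" for S :: "('a::euclidean_space \<times> real) set"
  using polyhedral_cone_sign_cone polyhedral_cone_def polyhedron_imp_convex by blast

text \<open>A closed cell depends only on the signs of its base point, and there are three signs.\<close>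

lemma finite_closed_cells:
  assumes "finite A"
  shows "finite (range (closed_cell A))"
proof -
  have "closed_cell A z =
      (\<lambda>s. sign_cone ((\<lambda>v. (v, s v)) ` A)) (restrict (\<lambda>v. sgn (v \<bullet> z)) A)" for z
    by (auto simp: closed_cell_def intro!: arg_cong[where f = sign_cone] image_cong)
  moreover have "restrict (\<lambda>v. sgn (v \<bullet> z)) A \<in> A \<rightarrow>\<^sub>E {-1, 0, 1::real}" for z
    by (auto simp: sgn_real_def)
  ultimately have "range (closed_cell A) \<subseteq>
      (\<lambda>s. sign_cone ((\<lambda>v. (v, s v)) ` A)) ` (A \<rightarrow>\<^sub>E {-1, 0, 1::real})"
    by blast
  then show ?thesis
    by (rule finite_subset) (intro finite_imageI finite_PiE assms, simp)
qed

text \<open>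
  A point \<open>x\<close> satisfying the weak inequalities is the limit of the points \<open>x + \<epsilon> z\<close>, \<open>\<epsilon> \<down> 0\<close>, which
  satisfy the strict ones.
\<close>

lemma closure_open_cell:
  fixes z :: "'a::euclidean_space"
  assumes "finite A"
  shows "closure {x. \<forall>v\<in>A. sgn (v \<bullet> x) = sgn (v \<bullet> z)} = closed_cell A z"
    (is "closure ?C = _")
proof (rule antisym)
  have "closed (closed_cell A z)"
    using polyhedral_cone_closed_cell[OF assms] polyhedral_cone_def polyhedron_imp_closed by blast
  then show "closure ?C \<subseteq> closed_cell A z"
    by (intro closure_minimal) (auto simp: mem_closed_cell)
  show "closed_cell A z \<subseteq> closure ?C"
  proof
    fix x assume x: "x \<in> closed_cell A z"
    have mem: "x + (1 / Suc n) *\<^sub>R z \<in> ?C" for n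
    proof (intro CollectI ballI)
      fix v assume "v \<in> A"
      then have "sgn (v \<bullet> x) \<in> {0, sgn (v \<bullet> z)}" using x by (simp add: mem_closed_cell)
      moreover define q where "q = (v \<bullet> z) / Suc n"
      have "v \<bullet> (x + (1 / Suc n) *\<^sub>R z) = v \<bullet> x + q"
        by (simp add: inner_add_right q_def)
      moreover have "sgn q = sgn (v \<bullet> z)"
        by (simp add: sgn_divide q_def)
      ultimately show "sgn (v \<bullet> (x + (1 / Suc n) *\<^sub>R z)) = sgn (v \<bullet> z)"
        by (simp only:) (auto simp: sgn_real_def split: if_splits)
    qed
    have "(\<lambda>n. x + (1 / Suc n) *\<^sub>R z) \<longlonglongrightarrow> x + 0 *\<^sub>R z"
      by (intro tendsto_intros LIMSEQ_Suc lim_1_over_n)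
    then show "x \<in> closure ?C"
      using mem unfolding closure_sequential
      by (intro exI[of _ "\<lambda>n. x + (1 / Suc n) *\<^sub>R z"]) simp
  qed
qed

text \<open>
  A point \<open>z\<close> in the relative interior of \<open>F\<close> has a zero sign only on vectors that vanish on all of
  \<open>F\<close>, so \<open>F\<close> lies in the closed cell of \<open>z\<close>. Conversely, a segment from a point \<open>x\<close> of this
  closed cell to \<open>z\<close> can be prolonged beyond \<open>z\<close> inside the cone, and
  the face property puts \<open>x\<close> into \<open>F\<close>.
\<close>

lemma face_of_sign_cone:
  fixes S :: "('a::euclidean_space \<times> real) set"
  assumes S: "finite S" and F: "F face_of sign_cone S" "F \<noteq> {}"
  obtains z where "F = closed_cell (fst ` S) z"
proof -
  have conv: "convex F" using F(1) by (rule face_of_imp_convex)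
  then obtain z where z: "z \<in> rel_interior F" using F(2) rel_interior_eq_empty by blast
  then have zF: "z \<in> F" using rel_interior_subset by blast
  have sub: "F \<subseteq> sign_cone S" using F(1) by (rule face_of_imp_subset)
  have "x \<in> closed_cell (fst ` S) z" if x: "x \<in> F" for x
    unfolding mem_closed_cell
  proof
    fix v assume "v \<in> fst ` S"
    then obtain s where vs: "(v, s) \<in> S" by auto
    \<comment> \<open>The segment from \<open>x\<close> to \<open>z\<close> can be prolonged inside \<open>F\<close>; if \<open>v\<close> vanished at \<open>z\<close> but not
      at \<open>x\<close>, it would change sign on \<open>F\<close>.\<close>
    obtain e where e: "e > 1" "(1 - e) *\<^sub>R x + e *\<^sub>R z \<in> F"
      using z x conv convex_rel_interior_iff2[of F z] F(2) convex_rel_interior_iff[of F z] by blast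
    have *: "sgn (v \<bullet> y) \<in> {0, s}" if "y \<in> F" for y
      using that sub vs by (auto simp: sign_cone_def)
    have "v \<bullet> z \<noteq> 0" if nz: "v \<bullet> x \<noteq> 0"
    proof
      assume "v \<bullet> z = 0"
      then have "v \<bullet> ((1 - e) *\<^sub>R x + e *\<^sub>R z) = (1 - e) * (v \<bullet> x)"
        by (simp add: inner_add_right)
      then have "sgn (v \<bullet> ((1 - e) *\<^sub>R x + e *\<^sub>R z)) = - sgn (v \<bullet> x)"
        using e(1) by (simp add: sgn_mult)
      then show False using *[OF e(2)] *[OF x] nz by (auto simp: sgn_real_def split: if_splits)
    qed
    then show "sgn (v \<bullet> x) \<in> {0, sgn (v \<bullet> z)}"
      using *[OF zF] *[OF x] by (auto simp: sgn_zero_iff)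
  qed
  moreover have "x \<in> F" if x: "x \<in> closed_cell (fst ` S) z" for x
  proof (cases "x = z")
    case False
    have xS: "x \<in> sign_cone S"
      using x zF sub by (fastforce simp: mem_closed_cell sign_cone_def)
    have lim: "((\<lambda>\<epsilon>. v \<bullet> (z + \<epsilon> *\<^sub>R (z - x))) \<longlongrightarrow> v \<bullet> (z + 0 *\<^sub>R (z - x))) (at_right 0)" for v
      by (intro tendsto_intros)
    have ev: "\<forall>\<^sub>F \<epsilon> in at_right 0. sgn (fst c \<bullet> (z + \<epsilon> *\<^sub>R (z - x))) \<in> {0, snd c}"
      if c: "c \<in> S" for c
    proof -
      obtain v s where vs: "c = (v, s)" by (cases c)
      have zs: "sgn (v \<bullet> z) \<in> {0, s}" using c zF sub by (auto simp: vs sign_cone_def)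
      consider "v \<bullet> z = 0" | "v \<bullet> z > 0" | "v \<bullet> z < 0" by linarith
      then show ?thesis
      proof cases
        case 1
        then have "v \<bullet> x = 0"
          using x c by (force simp: vs mem_closed_cell sgn_zero_iff)
        with 1 show ?thesis by (simp add: vs inner_add_right inner_diff_right)
      next
        case 2
        then show ?thesis
          using order_tendstoD(1)[OF lim[of v], of 0] zs
          by (auto simp: vs elim!: eventually_mono)
      next
        case 3
        then show ?thesis
          using order_tendstoD(2)[OF lim[of v], of 0] zs
          by (auto simp: vs elim!: eventually_mono)
      qed
    qed
    have "\<forall>\<^sub>F \<epsilon> in at_right (0::real).
        \<forall>c\<in>S. sgn (fst c \<bullet> (z + \<epsilon> *\<^sub>R (z - x))) \<in> {0, snd c}"
      by (intro eventually_ball_finite S ballI ev)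
    then have "\<forall>\<^sub>F \<epsilon> in at_right (0::real). 0 < \<epsilon> \<and> z + \<epsilon> *\<^sub>R (z - x) \<in> sign_cone S"
      using eventually_at_right_less[of "0::real"]
      by eventually_elim (force simp: sign_cone_def)
    then obtain \<epsilon> :: real where eps: "0 < \<epsilon>" "z + \<epsilon> *\<^sub>R (z - x) \<in> sign_cone S"
      using eventually_happens'[of "at_right (0::real)"] by auto
    let ?y = "z + \<epsilon> *\<^sub>R (z - x)"
    have "z \<in> open_segment x ?y"
    proof -
      define t where "t = 1 / (1 + \<epsilon>)"
      have t: "t * (1 + \<epsilon>) = 1" "0 < t" "t < 1" using eps(1) by (auto simp: t_def)
      have "?y - x = (1 + \<epsilon>) *\<^sub>R (z - x)" by (simp add: algebra_simps)
      then have "t *\<^sub>R (?y - x) = z - x" using t(1) by simp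
      then have "z = (1 - t) *\<^sub>R x + t *\<^sub>R ?y" by (simp add: algebra_simps)
      moreover have "x \<noteq> ?y"
      proof
        assume "x = ?y"
        then have "(1 + \<epsilon>) *\<^sub>R (z - x) = 0" by (simp add: algebra_simps)
        then show False using eps(1) False by auto
      qed
      ultimately show ?thesis using t(2,3) unfolding in_segment by blast
    qed
    then show ?thesis using F(1) xS eps(2) zF unfolding face_of_def by blast
  qed (use zF in simp)
  ultimately have "F = closed_cell (fst ` S) z" by blast
  then show ?thesis by (rule that)
qed

text \<open>
  On the closed cell of \<open>z\<^sub>1\<close> each \<open>v \<in> A\<close> has constant weak sign. Membership in the closed cell of
  \<open>z\<^sub>2\<close> asks it to vanish where the signs of \<open>z\<^sub>1\<close> and \<open>z\<^sub>2\<close> differ, and a sum of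
  two numbers of the same weak sign vanishes only if both do.
\<close>

lemma closed_cells_meet_in_face:
  fixes A :: "'a::euclidean_space set"
  assumes A: "finite A"
  shows "cone_face (closed_cell A z\<^sub>1 \<inter> closed_cell A z\<^sub>2) (closed_cell A z\<^sub>1)"
proof -
  have "a \<in> closed_cell A z\<^sub>2 \<and> b \<in> closed_cell A z\<^sub>2"
    if a: "a \<in> closed_cell A z\<^sub>1" and b: "b \<in> closed_cell A z\<^sub>1"
      and x: "x \<in> closed_cell A z\<^sub>2" "x \<in> open_segment a b" for a b x
  proof -
    obtain u where u: "0 < u" "u < 1" "x = (1 - u) *\<^sub>R a + u *\<^sub>R b"
      using x(2) by (auto simp: in_segment)
    have "sgn (v \<bullet> a) \<in> {0, sgn (v \<bullet> z\<^sub>2)} \<and> sgn (v \<bullet> b) \<in> {0, sgn (v \<bullet> z\<^sub>2)}"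
      if v: "v \<in> A" for v
    proof -
      define p q where "p = (1 - u) * (v \<bullet> a)" and "q = u * (v \<bullet> b)"
      have "sgn (v \<bullet> a) = sgn p" "sgn (v \<bullet> b) = sgn q" "v \<bullet> x = p + q"
        using u by (simp_all add: p_def q_def sgn_mult inner_add_right)
      moreover have "sgn (v \<bullet> a) \<in> {0, sgn (v \<bullet> z\<^sub>1)}" "sgn (v \<bullet> b) \<in> {0, sgn (v \<bullet> z\<^sub>1)}"
        "sgn (v \<bullet> x) \<in> {0, sgn (v \<bullet> z\<^sub>2)}"
        using a b x(1) v by (auto simp: mem_closed_cell)
      ultimately show ?thesis
        by (auto simp: sgn_real_def split: if_splits)
    qed
    then show ?thesis by (simp add: mem_closed_cell)
  qed
  moreover have "convex (closed_cell A z\<^sub>1 \<inter> closed_cell A z\<^sub>2)"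
    using A by (simp add: closed_cell_def convex_Int convex_sign_cone)
  moreover have "0 \<in> closed_cell A z\<^sub>1 \<inter> closed_cell A z\<^sub>2" by (simp add: mem_closed_cell)
  ultimately show ?thesis
    unfolding cone_face_def face_of_def by blast
qed

section \<open>Borel maxima\<close>

definition variable_rank :: "'n::{finite,linorder} \<Rightarrow> nat" where
  "variable_rank i = card {j. j \<le> i}"

lemma variable_rank_less: "i < j \<Longrightarrow> variable_rank i < variable_rank j"
  for i j :: "'n::{finite,linorder}"
  unfolding variable_rank_def by (rule psubset_card_mono) (auto simp: set_eq_iff dest: leD)

lemma less_next_ix:
  assumes "i < Max UNIV"
  shows "i < next_ix i"
proof -
  have "next_ix i \<in> {j. i < j}"
    unfolding next_ix_def using assms by (intro Min_in) auto
  then show ?thesis by simp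
qed

text \<open>
  An increasing move raises the sum of the ranks of the variables of a monomial, which makes the
  Borel order antisymmetric.
\<close>

definition rank_sum :: "('n::{finite,linorder} \<Rightarrow> int) \<Rightarrow> int" where
  "rank_sum a = (\<Sum>i\<in>UNIV. int (variable_rank i) * a i)"

lemma rank_sum_fun_upd: "rank_sum (a(i := c)) = rank_sum a + int (variable_rank i) * (c - a i)"
  by (simp add: rank_sum_def sum.remove[of UNIV i] algebra_simps)

lemma borel_step_rank_sum:
  assumes "borel_step a b"
  shows "rank_sum (gen_mon b) < rank_sum (gen_mon a)"
proof -
  obtain i where i: "i < Max UNIV" "gen_mon a = e_inc i (gen_mon b)"
    using assms by (auto simp: borel_step_def)
  then show ?thesis
    using less_next_ix[OF i(1)] variable_rank_less[OF less_next_ix[OF i(1)]]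
    by (auto simp: e_inc_def rank_sum_fun_upd)
qed

lemma borel_ge_rank_sum:
  assumes "borel_ge a b"
  shows "a = b \<or> rank_sum (gen_mon b) < rank_sum (gen_mon a)"
  using assms unfolding borel_ge_def
proof (induction rule: rtranclp_induct)
  case (step y z)
  then show ?case using borel_step_rank_sum[of y z] by auto
qed simp

lemma is_borel_max_unique:
  assumes "is_borel_max A a" "is_borel_max A b"
  shows "a = b"
  using assms borel_ge_rank_sum[of a b] borel_ge_rank_sum[of b a]
  by (force simp: is_borel_max_def)

lemma borel_adjacent_unique:
  "borel_adjacent r J J' a a' \<Longrightarrow> borel_adjacent r J J' b b' \<Longrightarrow> a = b \<and> a' = b'"
  using is_borel_max_unique unfolding borel_adjacent_def by blast

lemma borel_adjacent_commute:
  "borel_adjacent r J J' a a' \<Longrightarrow> borel_adjacent r J' J a' a"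
  unfolding borel_adjacent_def by blast

section \<open>The equivalence classes of weights as cells\<close>

definition exponent_vector :: "'n::finite mon \<Rightarrow> real ^ 'n" where
  "exponent_vector a = (\<chi> i. real (Poly_Mapping.lookup a i))"

definition edge_normals ::
    "'k::field itself \<Rightarrow> rat poly \<Rightarrow> (real ^ 'n::{finite,linorder}) set" where
  "edge_normals _ p = {exponent_vector a - exponent_vector a' | a a'.
     \<exists>J \<in> stable_ideals p. \<exists>J' \<in> stable_ideals p :: ('n, 'k) mpoly set set.
       borel_adjacent (gotzmann_number p) J J' a a'}"

lemma finite_mons_of_degree: "finite {m :: 'n::finite mon. mdeg m = r}"
proof -
  have "Poly_Mapping.lookup m i \<le> mdeg m" for m :: "'n mon" and i
    unfolding mdeg_def by (rule member_le_sum) auto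
  then have "Poly_Mapping.lookup ` {m :: 'n mon. mdeg m = r} \<subseteq> UNIV \<rightarrow>\<^sub>E {..r}"
    by (auto simp: PiE_def)
  then have "finite (Poly_Mapping.lookup ` {m :: 'n mon. mdeg m = r})"
    by (rule finite_subset) (auto intro: finite_PiE)
  then show ?thesis
    by (rule finite_imageD) (simp add: inj_on_def poly_mapping_eqI)
qed

lemma finite_edge_normals: "finite (edge_normals K p)"
proof -
  let ?M = "{m :: 'a mon. mdeg m = gotzmann_number p}"
  have "edge_normals K p \<subseteq>
      (\<lambda>(a, a'). exponent_vector a - exponent_vector a') ` (?M \<times> ?M)"
    by (force simp: edge_normals_def borel_adjacent_def is_borel_max_def mons_of_degree_def)
  then show ?thesis
    by (rule finite_subset) (intro finite_imageI finite_cartesian_product finite_mons_of_degree)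
qed

text \<open>
  The directed edges alone determine all the signs: adjacency is symmetric, so a negative sign
  for \<open>(J, J')\<close> shows as an edge from \<open>J'\<close> to \<open>J\<close>, and a zero sign as the lack of either edge.
\<close>

lemma degeneration_graph_eq_iff:
  fixes K :: "'k::field itself" and \<omega> \<sigma> :: "real ^ 'n::{finite,linorder}"
  shows "(degeneration_graph p \<omega> :: ('n, 'k) mpoly set mixed_graph) = degeneration_graph p \<sigma>
    \<longleftrightarrow> (\<forall>v \<in> edge_normals K p. sgn (v \<bullet> \<sigma>) = sgn (v \<bullet> \<omega>))"
    (is "?G \<omega> = ?G \<sigma> \<longleftrightarrow> ?R")
proof
  have dir: "(J, J') \<in> directed_edges (?G \<tau>) \<longleftrightarrow> weight a \<tau> > weight a' \<tau>"
    if "J \<in> stable_ideals p" "J' \<in> stable_ideals p"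
      "borel_adjacent (gotzmann_number p) J J' a a'" for J J' a a' \<tau>
  proof -
    have "(J, J') \<in> directed_edges (?G \<tau>) \<longleftrightarrow>
        (\<exists>b b'. borel_adjacent (gotzmann_number p) J J' b b' \<and> weight b \<tau> > weight b' \<tau>)"
      using that(1,2) by (simp add: degeneration_graph_def)
    then show ?thesis using that(3) borel_adjacent_unique[OF that(3)] by blast
  qed
  assume eq: "?G \<omega> = ?G \<sigma>"
  show ?R
  proof
    fix v assume "v \<in> (edge_normals K p :: (real ^ 'n::{finite,linorder}) set)"
    then obtain a a' and J J' :: "('n, 'k) mpoly set" where
      v: "v = exponent_vector a - exponent_vector a'"
      and J: "J \<in> stable_ideals p" "J' \<in> stable_ideals p"
      and adj: "borel_adjacent (gotzmann_number p) J J' a a'"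
      unfolding edge_normals_def by blast
    have "v \<bullet> \<tau> = weight a \<tau> - weight a' \<tau>" for \<tau>
      by (simp add: v weight_def exponent_vector_def inner_diff_left)
    moreover have "weight a \<omega> > weight a' \<omega> \<longleftrightarrow> weight a \<sigma> > weight a' \<sigma>"
      unfolding dir[OF J adj, symmetric] eq by (rule refl)
    moreover have "weight a' \<omega> > weight a \<omega> \<longleftrightarrow> weight a' \<sigma> > weight a \<sigma>"
      unfolding dir[OF J(2,1) borel_adjacent_commute[OF adj], symmetric] eq by (rule refl)
    ultimately show "sgn (v \<bullet> \<sigma>) = sgn (v \<bullet> \<omega>)"
      by (auto simp: sgn_real_def)
  qed
next
  assume R: ?R
  have "(weight a \<omega> > weight a' \<omega> \<longleftrightarrow> weight a \<sigma> > weight a' \<sigma>) \<and>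
      (weight a \<omega> = weight a' \<omega> \<longleftrightarrow> weight a \<sigma> = weight a' \<sigma>)"
    if "J \<in> stable_ideals p" "J' \<in> stable_ideals p"
      "borel_adjacent (gotzmann_number p) J J' a a'"
    for J J' :: "('n, 'k) mpoly set" and a a'
  proof -
    have "exponent_vector a - exponent_vector a' \<in> edge_normals K p"
      unfolding edge_normals_def using that by blast
    then have "sgn (weight a \<sigma> - weight a' \<sigma>) = sgn (weight a \<omega> - weight a' \<omega>)"
      using R unfolding weight_def exponent_vector_def inner_diff_left[symmetric] by blast
    then show ?thesis by (auto simp: sgn_real_def split: if_splits)
  qed
  then have
    "(\<exists>a a'. borel_adjacent (gotzmann_number p) J J' a a' \<and> weight a \<omega> = weight a' \<omega>) \<longleftrightarrow>
     (\<exists>a a'. borel_adjacent (gotzmann_number p) J J' a a' \<and> weight a \<sigma> = weight a' \<sigma>)"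
    "(\<exists>a a'. borel_adjacent (gotzmann_number p) J J' a a' \<and> weight a' \<omega> < weight a \<omega>) \<longleftrightarrow>
     (\<exists>a a'. borel_adjacent (gotzmann_number p) J J' a a' \<and> weight a' \<sigma> < weight a \<sigma>)"
    if "J \<in> stable_ideals p" "J' \<in> stable_ideals p" for J J' :: "('n, 'k) mpoly set"
    using that by meson+
  then show "?G \<omega> = ?G \<sigma>"
    unfolding degeneration_graph_def by (simp cong: conj_cong)
qed

lemma closure_graph_equiv_class:
  fixes K :: "'k::field itself"
  shows "closure (graph_equiv K p `` {\<omega>}) = closed_cell (edge_normals K p) \<omega>"
proof -
  have "graph_equiv K p `` {\<omega>} = {\<sigma>. \<forall>v \<in> edge_normals K p. sgn (v \<bullet> \<sigma>) = sgn (v \<bullet> \<omega>)}"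
    by (simp add: graph_equiv_def Image_def degeneration_graph_eq_iff[where K = K])
  then show ?thesis using closure_open_cell[OF finite_edge_normals] by simp
qed

section \<open>The weight chamber as a cell\<close>

definition wall_normals :: "(real ^ 'n::{finite,linorder}) set" where
  "wall_normals = range (\<lambda>i. axis i 1) \<union>
     (\<lambda>i. axis (next_ix i) 1 - axis i 1) ` {i. i < Max UNIV}"

lemma finite_wall_normals: "finite wall_normals"
  by (simp add: wall_normals_def)

lemma weight_chamber_eq: "weight_chamber = {\<omega>. \<forall>u\<in>wall_normals. 0 < u \<bullet> \<omega>}"
  unfolding weight_chamber_def wall_normals_def ball_Un ball_simps
  by (simp add: inner_diff_left inner_axis')

text \<open>A cell needs a base point: here the weight whose entries are the ranks of the variables.\<close>

lemma closure_weight_chamber: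
  obtains w :: "real ^ 'n::{finite,linorder}"
    where "closure weight_chamber = closed_cell wall_normals w"
proof -
  define w :: "real ^ 'n::{finite,linorder}" where "w = (\<chi> i. real (variable_rank i))"
  have "0 < variable_rank i" for i :: 'n
    unfolding variable_rank_def by (auto simp: card_gt_0_iff)
  then have "w \<in> weight_chamber"
    by (auto simp: weight_chamber_def w_def variable_rank_less less_next_ix)
  then have "weight_chamber = {x. \<forall>u\<in>wall_normals. sgn (u \<bullet> x) = sgn (u \<bullet> w)}"
    by (auto simp: weight_chamber_eq sgn_1_pos)
  then have "closure weight_chamber = closed_cell wall_normals w"
    using closure_open_cell[OF finite_wall_normals] by (rule ssubst)
  then show ?thesis by (rule that)
qed

section \<open>The fan\<close>

text \<open>
  This covers the generating cones as well as their faces, because a cone is a face of itself.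
\<close>

lemma groebner_fan_closed_cell:
  fixes C :: "(real ^ 'n::{finite,linorder}) set"
  assumes "C \<in> groebner_fan K p"
  obtains z where "C = closed_cell (edge_normals K p \<union> wall_normals) z"
proof -
  obtain w :: "real ^ 'n::{finite,linorder}"
    where w: "closure weight_chamber = closed_cell wall_normals w"
    by (rule closure_weight_chamber)
  obtain D where D: "D \<in> groebner_cones K p" "C = D \<or> cone_face C D"
    using assms by (auto simp: groebner_fan_def)
  obtain \<omega> where "D = closure (graph_equiv K p `` {\<omega>}) \<inter> closure weight_chamber"
    using D(1) by (auto simp: groebner_cones_def quotient_def)
  then have D_eq: "D = sign_cone ((\<lambda>v. (v, sgn (v \<bullet> \<omega>))) ` edge_normals K p \<union>
      (\<lambda>v. (v, sgn (v \<bullet> w))) ` wall_normals)" (is "D = sign_cone ?S")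
    by (simp add: closure_graph_equiv_class w closed_cell_def sign_cone_Un)
  have S: "finite ?S" by (simp add: finite_edge_normals finite_wall_normals)
  have "D face_of D" "D \<noteq> {}"
    using convex_sign_cone[OF S] polyhedral_cone_sign_cone[OF S]
    unfolding D_eq polyhedral_cone_def by (blast intro: face_of_refl)+
  then have "C face_of sign_cone ?S" "C \<noteq> {}"
    using D(2) unfolding D_eq cone_face_def by blast+
  then obtain z where "C = closed_cell (fst ` ?S) z"
    by (rule face_of_sign_cone[OF S])
  moreover have "fst ` ?S = edge_normals K p \<union> wall_normals"
    by (simp add: image_Un image_image)
  ultimately show ?thesis using that by simp
qed

theorem theorem4p13:
  fixes Z :: "('n::{finite,linorder}, 'k::{alg_closed_field,field_char_0}) mpoly set"
    and p :: "rat poly"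
  assumes "homogeneous_ideal Z" and "saturated Z"
    and "has_hilbert_poly Z p"
  shows "polyhedral_fan (groebner_fan TYPE('k) p :: (real ^ 'n::{finite,linorder}) set set)"
proof -
  let ?A = "edge_normals TYPE('k) p \<union> wall_normals :: (real ^ 'n::{finite,linorder}) set"
  let ?fan = "groebner_fan TYPE('k) p :: (real ^ 'n::{finite,linorder}) set set"
  have A: "finite ?A" by (simp add: finite_edge_normals finite_wall_normals)
  have cell: "\<exists>z. C = closed_cell ?A z" if "C \<in> ?fan" for C
    using groebner_fan_closed_cell[OF that] by metis
  show ?thesis
    unfolding polyhedral_fan_def
  proof (intro conjI ballI allI impI)
    show "finite ?fan"
      using cell by (intro finite_subset[OF _ finite_closed_cells[OF A]]) blast
    show "polyhedral_cone C" if "C \<in> ?fan" for C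
      using cell[OF that] polyhedral_cone_closed_cell[OF A] by blast
    show "F \<in> ?fan" if "C \<in> ?fan" "cone_face F C" for C F
      using that unfolding groebner_fan_def cone_face_def by (blast intro: face_of_trans)
    show "cone_face (C\<^sub>1 \<inter> C\<^sub>2) C\<^sub>1" "cone_face (C\<^sub>1 \<inter> C\<^sub>2) C\<^sub>2"
      if "C\<^sub>1 \<in> ?fan" "C\<^sub>2 \<in> ?fan" for C\<^sub>1 C\<^sub>2
      using cell[OF that(1)] cell[OF that(2)] closed_cells_meet_in_face[OF A]
      by (metis Int_commute)+
  qed
qed

end
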